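(* Let $\sigma\in(0,1)$, let $\mathcal{C}\subseteq\mathbb{R}^2$ be a curve (of finite length, not necessarily connected), let $z\in\mathbb{R}^2$, and let $\mathbf{u}$ be a unit vector, where, if $z\in\mathcal{C}$, $\mathbf{u}$ is one of the unit normals to $\mathcal{C}$ at $z$. Let $\mathcal{P}_-=\{p\in\mathbb{R}^2 \mid (p-z)\cdot\mathbf{u}\le0\}$ and $\mathcal{P}_+=\{p\in\mathbb{R}^2 \mid (p-z)\cdot\mathbf{u}\ge0\}$. Setting $\mathcal{C}_+:=\mathcal{C}\cap\mathrm{Int}(\mathcal{P}_+)$ and $\mathcal{C}_-:=\mathcal{C}\cap\mathrm{Int}(\mathcal{P}_-)$, we have $$\kappa_\sigma(z,\mathcal{C},\mathbf{u})=\kappa_\sigma(z,\mathcal{C}_+,\mathbf{u})+\kappa_\sigma(z,\mathcal{C}_-,\mathbf{u}).$$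
   Context: Curves. A curve $\mathcal{C}$ is a one-dimensional $C^1$ manifold with boundary in $\mathbb{R}^2$ (a simple, $C^1$ planar curve, not necessarily connected) of finite length. Some or all endpoints may be removed, and the definitions below also make sense when $\mathcal{C}$ is only piecewise $C^1$ (if $z\in\mathcal{C}$, then $z$ must be a point where $\mathcal{C}$ is $C^1$). For $x,y\in\mathbb{R}^2$, $[x,y]$ denotes the closed line segment with endpoints $x$ and $y$. $\mathrm{Int}$ denotes topological interior. Transversality. An open line segment $\mathcal{L}$ and $\mathcal{C}$ are transversal if at every $p\in\mathcal{L}\cap\mathcal{C}$ the tangent to $\mathcal{C}$ at $p$ is not parallel to $\mathcal{L}$. $\mathcal{X}(\mathcal{C})$ is the set of all pairs $(x,y)\in\mathbb{R}^2\times\mathbb{R}^2$ such that the open line segment $\mathcal{L}$ connecting $x$ and $y$ is transversal to $\mathcal{C}$ and $\mathcal{C}\cap\mathcal{L}$ has an odd number of elements; $\mathcal{X}(\mathcal{C})^c$ is its complement. Nonlocal curvature. For $z\in\mathcal{C}$ and a unit normal $\mathbf{u}$ to $\mathcal{C}$ at $z$, set $$\mathcal{A}_e(z)=\{y \mid ((z,y)\in\mathcal{X}(\mathcal{C})\text{ and }(z-y)\cdot\mathbf{u}>0)\text{ or }((z,y)\in\mathcal{X}(\mathcal{C})^c\text{ and }(z-y)\cdot\mathbf{u}<0)\},$$ $$\mathcal{A}_i(z)=\{y \mid ((z,y)\in\mathcal{X}(\mathcal{C})^c\text{ and }(z-y)\cdot\mathbf{u}>0)\text{ or }((z,y)\in\mathcal{X}(\mathcal{C})\text{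 and }(z-y)\cdot\mathbf{u}<0)\},$$ let $\widehat\chi_{\mathcal{C}}(z,y)$ equal $1$ if $y\in\mathcal{A}_i(z)$, $-1$ if $y\in\mathcal{A}_e(z)$, and $0$ otherwise, and define (principal value) $$\kappa_\sigma(z,\mathcal{C},\mathbf{u})=\lim_{\varepsilon\to0}\frac12\int_{\mathbb{R}^2\setminus B_\varepsilon(z)}\frac{\widehat\chi_{\mathcal{C}}(z,y)}{|z-y|^{2+\sigma}}\,dy,$$ where $B_\varepsilon(z)$ is the ball of radius $\varepsilon$ centered at $z$. For $z\notin\mathcal{C}$ and an arbitrary unit vector $\mathbf{u}$, define $$\kappa_\sigma(z,\mathcal{C},\mathbf{u})=\lim_{\delta\downarrow0}\kappa_\sigma(z,\mathcal{C}\cup[z-\delta\mathbf{u}^\perp,z+\delta\mathbf{u}^\perp],\mathbf{u}),$$ where $\mathbf{u}^\perp$ is $\mathbf{u}$ rotated clockwise by $90^\circ$. In particular $\kappa_\sigma(z,\emptyset,\mathbf{u})=0$.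
   Formalization: The principal-value limits defining the curvatures of C_+ and C_- at z are assumed to exist as real numbers (they can diverge for merely C^1 curves); existence of the curvature of C is then concluded along with the equality. *)

theory Defs
  imports "HOL-Analysis.Analysis"
begin

section \<open>Curves\<close>

text \<open>
  A one-dimensional \<open>C\<^sup>1\<close> submanifold of the plane, possibly with boundary: every point has a
  relatively open neighbourhood that is the homeomorphic image, under a regular \<open>C\<^sup>1\<close> map, of an
  open interval or (at a boundary point, which corresponds to \<open>0\<close>) of a half-open one.
  \<open>C1_differentiable_on\<close> asks for two-sided derivatives, so at the closed end of the half-open
  interval the map is a \<open>C\<^sup>1\<close> extension.  Deleting boundary points leaves such a set, hence missing
  endpoints need no separate treatment.
\<close>

definition C1_curve :: "(real^2) set \<Rightarrow> bool" where
  "C1_curve C \<longleftrightarrow>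
    (\<forall>p\<in>C. \<exists>U I \<gamma> g. open U \<and> p \<in> U \<and> (I = {-1<..<1} \<or> I = {0..<1}) \<and>
       \<gamma> C1_differentiable_on I \<and> (\<forall>t\<in>I. vector_derivative \<gamma> (at t) \<noteq> 0) \<and>
       homeomorphism I (C \<inter> U) \<gamma> g \<and> \<gamma> 0 = p)"

text \<open>
  The length of a possibly disconnected curve is the supremum of the total length of finitely many
  disjoint injective \<open>C\<^sup>1\<close> arcs contained in it.
\<close>

definition finite_length :: "(real^2) set \<Rightarrow> bool" where
  "finite_length C \<longleftrightarrow>
    (\<exists>M. \<forall>n (\<gamma> :: nat \<Rightarrow> real \<Rightarrow> real^2).
       (\<forall>i<n. \<gamma> i C1_differentiable_on {0..1} \<and> inj_on (\<gamma> i) {0..1} \<and> path_image (\<gamma> i) \<subseteq> C) \<and>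
       disjoint_family_on (\<lambda>i. path_image (\<gamma> i)) {..<n} \<longrightarrow>
       (\<Sum>i<n. integral {0..1} (\<lambda>t. norm (vector_derivative (\<gamma> i) (at t)))) \<le> M)"

definition planar_curve :: "(real^2) set \<Rightarrow> bool" where
  "planar_curve C \<longleftrightarrow> C1_curve C \<and> finite_length C"

text \<open>
  Velocities at \<open>p\<close> of motions that start at \<open>p\<close> and stay in \<open>C\<close>.  For a \<open>C\<^sup>1\<close> curve this is the
  tangent line at an interior point and a ray spanning it at a boundary point; it always
  contains \<open>0\<close>.
\<close>

definition tangent_vectors :: "(real^2) set \<Rightarrow> real^2 \<Rightarrow> (real^2) set" where
  "tangent_vectors C p =
    {v. \<exists>\<gamma>. \<gamma> 0 = p \<and> (\<forall>t\<ge>0. \<gamma> t \<in> C) \<and> (\<gamma> has_vector_derivative v) (at 0 within {0..})}"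

definition unit_normal :: "(real^2) set \<Rightarrow> real^2 \<Rightarrow> real^2 \<Rightarrow> bool" where
  "unit_normal C p u \<longleftrightarrow> norm u = 1 \<and> (\<forall>v\<in>tangent_vectors C p. v \<bullet> u = 0)"

section \<open>Transversality\<close>

definition transversal :: "real^2 \<Rightarrow> real^2 \<Rightarrow> (real^2) set \<Rightarrow> bool" where
  "transversal x y C \<longleftrightarrow>
    (\<forall>p\<in>open_segment x y \<inter> C. \<forall>v\<in>tangent_vectors C p. v \<noteq> 0 \<longrightarrow> v \<notin> span {y - x})"

text \<open>\<open>card\<close> is \<open>0\<close> on infinite sets, so an odd cardinality implies finiteness.\<close>

definition odd_pairs :: "(real^2) set \<Rightarrow> ((real^2) \<times> (real^2)) set" where
  "odd_pairs C = {(x, y). transversal x y C \<and> odd (card (C \<inter> open_segment x y))}"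

section \<open>Nonlocal curvature\<close>

definition exterior_set :: "real^2 \<Rightarrow> (real^2) set \<Rightarrow> real^2 \<Rightarrow> (real^2) set" where
  "exterior_set z C u =
    {y. ((z, y) \<in> odd_pairs C \<and> (z - y) \<bullet> u > 0) \<or> ((z, y) \<notin> odd_pairs C \<and> (z - y) \<bullet> u < 0)}"

definition interior_set :: "real^2 \<Rightarrow> (real^2) set \<Rightarrow> real^2 \<Rightarrow> (real^2) set" where
  "interior_set z C u =
    {y. ((z, y) \<notin> odd_pairs C \<and> (z - y) \<bullet> u > 0) \<or> ((z, y) \<in> odd_pairs C \<and> (z - y) \<bullet> u < 0)}"

definition chi_hat :: "(real^2) set \<Rightarrow> real^2 \<Rightarrow> real^2 \<Rightarrow> real^2 \<Rightarrow> real" where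
  "chi_hat C u z y =
    (if y \<in> interior_set z C u then 1 else if y \<in> exterior_set z C u then -1 else 0)"

definition truncated_curvature ::
    "real \<Rightarrow> real^2 \<Rightarrow> (real^2) set \<Rightarrow> real^2 \<Rightarrow> real \<Rightarrow> real" where
  "truncated_curvature \<sigma> z C u \<epsilon> =
    1/2 * (LINT y : - ball z \<epsilon> | lborel. chi_hat C u z y / norm (z - y) powr (2 + \<sigma>))"

definition pv_curvature :: "real \<Rightarrow> real^2 \<Rightarrow> (real^2) set \<Rightarrow> real^2 \<Rightarrow> real" where
  "pv_curvature \<sigma> z C u = Lim (at_right 0) (truncated_curvature \<sigma> z C u)"

definition pv_curvature_exists :: "real \<Rightarrow> real^2 \<Rightarrow> (real^2) set \<Rightarrow> real^2 \<Rightarrow> bool" where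
  "pv_curvature_exists \<sigma> z C u \<longleftrightarrow> (\<exists>k. (truncated_curvature \<sigma> z C u \<longlongrightarrow> k) (at_right 0))"

definition rot_clockwise :: "real^2 \<Rightarrow> real^2" where
  "rot_clockwise u = vector [u $ 2, - (u $ 1)]"

definition add_segment :: "real^2 \<Rightarrow> (real^2) set \<Rightarrow> real^2 \<Rightarrow> real \<Rightarrow> (real^2) set" where
  "add_segment z C u \<delta> =
    C \<union> closed_segment (z - \<delta> *\<^sub>R rot_clockwise u) (z + \<delta> *\<^sub>R rot_clockwise u)"

definition nonlocal_curvature :: "real \<Rightarrow> real^2 \<Rightarrow> (real^2) set \<Rightarrow> real^2 \<Rightarrow> real" where
  "nonlocal_curvature \<sigma> z C u =
    (if z \<in> C then pv_curvature \<sigma> z C u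
     else Lim (at_right 0) (\<lambda>\<delta>. pv_curvature \<sigma> z (add_segment z C u \<delta>) u))"

text \<open>
  All limits occurring in \<open>nonlocal_curvature\<close> exist in the reals; otherwise its value is
  unspecified.  For curves that are merely \<open>C\<^sup>1\<close> the principal value may diverge.
\<close>

definition nonlocal_curvature_exists :: "real \<Rightarrow> real^2 \<Rightarrow> (real^2) set \<Rightarrow> real^2 \<Rightarrow> bool" where
  "nonlocal_curvature_exists \<sigma> z C u \<longleftrightarrow>
    (if z \<in> C then pv_curvature_exists \<sigma> z C u
     else (\<forall>\<^sub>F \<delta> in at_right 0. pv_curvature_exists \<sigma> z (add_segment z C u \<delta>) u) \<and>
       (\<exists>k. ((\<lambda>\<delta>. pv_curvature \<sigma> z (add_segment z C u \<delta>) u) \<longlongrightarrow> k) (at_right 0)))"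

end

theory Submission
  imports Defs
begin

text \<open>
  A segment from \<open>z\<close> to a point \<open>y\<close> of an open half-plane bounded by the line through \<open>z\<close> orthogonal
  to \<open>u\<close> stays in that half-plane, so it sees only the part of the curve there.  Hence
  \<open>\<chi>\<^bsub>C\<^esub> = \<chi>\<^bsub>C+\<^esub> + \<chi>\<^bsub>C-\<^esub> + sgn ((y - z) \<bullet> u)\<close>, and the last term
  integrates to \<open>0\<close> by reflection at \<open>z\<close>.  Since the Bochner integral of a nonintegrable function is
  \<open>0\<close>, splitting the integral requires \<open>\<chi>\<close> to be Borel measurable.  This holds because \<open>C\<close> is
  \<open>\<sigma>\<close>-compact: the \<open>y\<close> whose segment meets \<open>C\<close> in at least \<open>k\<close> points, and those whose segment
  meets the \<open>\<sigma>\<close>-compact set of points of \<open>C\<close> with tangent pointing towards \<open>z\<close>, are obtained from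
  projections of \<open>\<sigma>\<close>-compact sets along the rays from \<open>z\<close>.
\<close>

section \<open>F-sigma sets and crossings of rays\<close>

text \<open>Euclidean space is a countable union of compact sets, so closed pieces can be cut into
  compact ones. Unlike closed pieces, these survive continuous images and hence projections.\<close>

lemma fsigma_in_compactE:
  fixes S :: "'a::euclidean_space set"
  assumes "fsigma_in euclidean S"
  obtains K :: "nat \<Rightarrow> 'a set" where "\<And>n. compact (K n)" "S = (\<Union>n. K n)"
proof -
  obtain F :: "nat \<Rightarrow> 'a set" where F: "\<And>n. closed (F n)" "S = (\<Union>n. F n)"
    using assms by (auto simp: fsigma_in_ascending)
  then have "fsigma S"
    by (auto intro: fsigma.intros)
  then obtain K :: "nat \<Rightarrow> 'a set" where "range K \<subseteq> Collect compact" "S = \<Union>(range K)"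
    using fsigma_Union_compact by blast
  then show thesis
    by (intro that[of K]) auto
qed

lemma fsigma_in_UN:
  assumes "countable I" "\<And>i. i \<in> I \<Longrightarrow> fsigma_in X (A i)"
  shows "fsigma_in X (\<Union>i\<in>I. A i)"
  using assms by (intro fsigma_in_Union) auto

lemma open_imp_fsigma_euclidean:
  fixes S :: "'a::euclidean_space set"
  assumes "open S"
  shows "fsigma_in euclidean S"
proof -
  obtain K :: "nat \<Rightarrow> 'a set" where K: "\<And>n. compact (K n)" "(\<Union>n. K n) = S"
    using open_Union_compact_subsets[OF assms] by metis
  show ?thesis
    unfolding K(2)[symmetric]
    by (intro fsigma_in_UN closed_imp_fsigma_in) (use K(1) compact_imp_closed in auto)
qed

lemma fsigma_in_continuous_image:
  fixes f :: "'a::euclidean_space \<Rightarrow> 'b::euclidean_space"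
  assumes "continuous_on S f" "fsigma_in euclidean S"
  shows "fsigma_in euclidean (f ` S)"
proof -
  obtain K :: "nat \<Rightarrow> 'a set" where K: "\<And>n. compact (K n)" "S = (\<Union>n. K n)"
    using fsigma_in_compactE[OF assms(2)] by blast
  have "compact (f ` K n)" for n
    using K assms(1) by (intro compact_continuous_image) (auto intro: continuous_on_subset)
  then show ?thesis
    unfolding K(2) image_UN by (intro fsigma_in_UN closed_imp_fsigma_in) (auto simp: compact_imp_closed)
qed

lemma fsigma_in_Times:
  fixes S :: "'a::euclidean_space set" and T :: "'b::euclidean_space set"
  assumes "fsigma_in euclidean S" "fsigma_in euclidean T"
  shows "fsigma_in euclidean (S \<times> T)"
proof -
  obtain K :: "nat \<Rightarrow> 'a set" where K: "\<And>n. compact (K n)" "S = (\<Union>n. K n)"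
    using fsigma_in_compactE[OF assms(1)] by blast
  obtain L :: "nat \<Rightarrow> 'b set" where L: "\<And>n. compact (L n)" "T = (\<Union>n. L n)"
    using fsigma_in_compactE[OF assms(2)] by blast
  have "S \<times> T = (\<Union>i. \<Union>j. K i \<times> L j)"
    unfolding K(2) L(2) by auto
  also have "fsigma_in euclidean \<dots>"
    using K(1) L(1)
    by (intro fsigma_in_UN closed_imp_fsigma_in) (auto simp: compact_Times compact_imp_closed)
  finally show ?thesis .
qed

lemma fsigma_in_imp_borel:
  fixes S :: "'a::topological_space set"
  assumes "fsigma_in euclidean S"
  shows "S \<in> sets borel"
  using assms by (auto simp: fsigma_in_ascending)

text \<open>By Lindelof countably many of the good neighbourhoods already cover the set. This allows
  curves to be treated one chart at a time.\<close>

lemma fsigma_in_locally: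
  fixes X :: "'a::euclidean_space set"
  assumes "\<And>p. p \<in> X \<Longrightarrow> \<exists>U. open U \<and> p \<in> U \<and> fsigma_in euclidean (X \<inter> U)"
  shows "fsigma_in euclidean X"
proof -
  obtain \<F>' where F: "\<F>' \<subseteq> {U. open U \<and> fsigma_in euclidean (X \<inter> U)}" "countable \<F>'"
    "\<Union>\<F>' = \<Union>{U. open U \<and> fsigma_in euclidean (X \<inter> U)}"
    by (rule Lindelof[of "{U. open U \<and> fsigma_in euclidean (X \<inter> U)}"]) auto
  have "X = (\<Union>U\<in>\<F>'. X \<inter> U)"
    using assms F(3) by blast
  also have "fsigma_in euclidean \<dots>"
    using F by (intro fsigma_in_UN) auto
  finally show ?thesis .
qed

text \<open>The quantifier over \<open>s\<close> ranges over an uncountable set. Solving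
  \<open>p = z + s *\<^sub>R (y - z)\<close> for \<open>y\<close> turns the set into an image of
  \<open>A \<times> J\<close> under a map that is continuous because \<open>s\<close> never
  vanishes.\<close>

lemma fsigma_in_ray_preimage:
  fixes A :: "'a::euclidean_space set"
  assumes "fsigma_in euclidean A" "fsigma_in euclidean J" "0 \<notin> J"
  shows "fsigma_in euclidean {y. \<exists>s\<in>J. z + s *\<^sub>R (y - z) \<in> A}"
proof -
  have "{y. \<exists>s\<in>J. z + s *\<^sub>R (y - z) \<in> A} = (\<lambda>(p, s). z + (p - z) /\<^sub>R s) ` (A \<times> J)"
  proof (intro equalityI subsetI)
    fix y assume "y \<in> {y. \<exists>s\<in>J. z + s *\<^sub>R (y - z) \<in> A}"
    then obtain s where s: "s \<in> J" "z + s *\<^sub>R (y - z) \<in> A" by auto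
    then have "s \<noteq> 0"
      using assms(3) by auto
    then have "y = z + (z + s *\<^sub>R (y - z) - z) /\<^sub>R s"
      by simp
    then show "y \<in> (\<lambda>(p, s). z + (p - z) /\<^sub>R s) ` (A \<times> J)"
      using s by (intro image_eqI[of _ _ "(z + s *\<^sub>R (y - z), s)"]) auto
  next
    fix y assume "y \<in> (\<lambda>(p, s). z + (p - z) /\<^sub>R s) ` (A \<times> J)"
    then obtain p s where s: "p \<in> A" "s \<in> J" "y = z + (p - z) /\<^sub>R s" by auto
    moreover from s have "s \<noteq> 0" using assms(3) by auto
    ultimately show "y \<in> {y. \<exists>s\<in>J. z + s *\<^sub>R (y - z) \<in> A}"
      by (auto intro!: bexI[of _ s])
  qed
  also have "fsigma_in euclidean \<dots>"
    using assms unfolding case_prod_unfold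
    by (intro fsigma_in_continuous_image fsigma_in_Times continuous_intros) auto
  finally show ?thesis .
qed

text \<open>Stated through finite subsets so that infinite sets satisfy it for every
  \<open>k\<close>, whereas \<open>k \<le> card S\<close> would fail there for positive
  \<open>k\<close>.\<close>

definition at_least :: "nat \<Rightarrow> 'a set \<Rightarrow> bool" where
  "at_least k S \<longleftrightarrow> (\<exists>T\<subseteq>S. finite T \<and> card T = k)"

text \<open>For finite \<open>S\<close> the only possible \<open>k\<close> is \<open>card S\<close>.
  For infinite \<open>S\<close> both sides are false: \<open>card S\<close> is 0, and no
  \<open>k\<close> is the last one attained.\<close>

lemma odd_card_iff_at_least:
  "odd (card S) \<longleftrightarrow> (\<exists>k. odd k \<and> at_least k S \<and> \<not> at_least (Suc k) S)"
proof (cases "finite S")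
  case True
  then have "at_least k S \<longleftrightarrow> k \<le> card S" for k
    unfolding at_least_def by (metis card_mono obtain_subset_with_card_n)
  then show ?thesis
    by (metis not_less_eq_eq le_antisym order_refl)
next
  case False
  then have "at_least k S" for k
    unfolding at_least_def using infinite_arbitrarily_large by blast
  then show ?thesis
    using False by simp
qed

text \<open>A rational \<open>q\<close> separates the smallest chosen point from the others, which makes the condition a
  countable union.\<close>

lemma at_least_Suc_iff:
  fixes S :: "real set"
  shows "at_least (Suc k) (S \<inter> {a<..}) \<longleftrightarrow>
    (\<exists>q\<in>\<rat>. S \<inter> {a<..q} \<noteq> {} \<and> at_least k (S \<inter> {a<..} \<inter> {q<..}))"
proof
  assume "at_least (Suc k) (S \<inter> {a<..})"
  then obtain T where T: "T \<subseteq> S \<inter> {a<..}" "finite T" "card T = Suc k"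
    by (auto simp: at_least_def)
  define m where "m = Min T"
  have "T \<noteq> {}" using T by auto
  then have m: "m \<in> T" "\<And>t. t \<in> T \<Longrightarrow> m \<le> t"
    using T by (auto simp: m_def)
  \<comment> \<open>\<open>b\<close> is the second smallest chosen point, or any number above
    \<open>m\<close> if \<open>m\<close> is the only one.\<close>
  obtain b where b: "m < b" "\<And>t. t \<in> T - {m} \<Longrightarrow> b \<le> t"
  proof (cases "T - {m} = {}")
    case True then show thesis using that[of "m + 1"] by auto
  next
    case False
    then have "Min (T - {m}) \<in> T - {m}" using T by (intro Min_in) auto
    then have "m < Min (T - {m})"
      using m(2)[of "Min (T - {m})"] by auto
    then show thesis
      using that[of "Min (T - {m})"] T(2) by simp
  qed
  obtain q where q: "q \<in> \<rat>" "m < q" "q < b"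
    using Rats_dense_in_real[OF b(1)] by blast
  have "at_least k (S \<inter> {a<..} \<inter> {q<..})"
    unfolding at_least_def using T m b(2) q by (intro exI[of _ "T - {m}"]) fastforce
  then show "\<exists>q\<in>\<rat>. S \<inter> {a<..q} \<noteq> {} \<and> at_least k (S \<inter> {a<..} \<inter> {q<..})"
    using q m T by (intro bexI[of _ q] conjI) (auto simp: set_eq_iff intro!: exI[of _ m])
next
  assume "\<exists>q\<in>\<rat>. S \<inter> {a<..q} \<noteq> {} \<and> at_least k (S \<inter> {a<..} \<inter> {q<..})"
  then obtain q s T where q: "s \<in> S \<inter> {a<..q}" "T \<subseteq> S \<inter> {a<..} \<inter> {q<..}" "finite T" "card T = k"
    unfolding at_least_def by blast
  then have "s \<notin> T" by auto
  then show "at_least (Suc k) (S \<inter> {a<..})"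
    unfolding at_least_def using q by (intro exI[of _ "insert s T"]) auto
qed

text \<open>Induction on \<open>k\<close> with the lower bound \<open>a\<close> kept general:
  splitting off a first crossing at or before a rational \<open>q\<close> leaves \<open>k\<close>
  crossings to be found beyond \<open>max a q\<close>.\<close>

lemma borel_at_least_on_ray:
  fixes A :: "'a::euclidean_space set"
  assumes A: "fsigma_in euclidean A"
  shows "{y. at_least k ({s\<in>{0<..<1}. z + s *\<^sub>R (y - z) \<in> A} \<inter> {a<..})} \<in> sets borel"
proof (induction k arbitrary: a)
  case 0
  have "at_least 0 S" for S :: "real set"
    by (auto simp: at_least_def)
  then show ?case by simp
next
  case (Suc k)
  let ?S = "\<lambda>y. {s\<in>{0<..<1}. z + s *\<^sub>R (y - z) \<in> A}"
  have hit: "{y. ?S y \<inter> {a<..q} \<noteq> {}} \<in> sets borel" for q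
  proof -
    have "fsigma_in euclidean ({0<..<1} \<inter> ({a<..} \<inter> {..q}))"
      by (intro fsigma_in_Int open_imp_fsigma_euclidean[OF open_greaterThanLessThan]
          open_imp_fsigma_euclidean[OF open_greaterThan] closed_imp_fsigma_in) auto
    moreover have "{a<..} \<inter> {..q} = {a<..q}" by auto
    ultimately have "fsigma_in euclidean ({0<..<1} \<inter> {a<..q})"
      by (simp only:)
    then have "fsigma_in euclidean {y. \<exists>s\<in>{0<..<1} \<inter> {a<..q}. z + s *\<^sub>R (y - z) \<in> A}"
      by (intro fsigma_in_ray_preimage[OF A]) auto
    moreover have "{y. ?S y \<inter> {a<..q} \<noteq> {}} = {y. \<exists>s\<in>{0<..<1} \<inter> {a<..q}. z + s *\<^sub>R (y - z) \<in> A}"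
      by blast
    ultimately show ?thesis by (simp add: fsigma_in_imp_borel)
  qed
  have "{y. at_least (Suc k) (?S y \<inter> {a<..})} =
      (\<Union>q\<in>\<rat>. {y. ?S y \<inter> {a<..q} \<noteq> {}} \<inter> {y. at_least k (?S y \<inter> {max a q<..})})"
  proof -
    have max: "?S y \<inter> {max a q<..} = ?S y \<inter> {a<..} \<inter> {q<..}" for y q by auto
    show ?thesis unfolding at_least_Suc_iff max by blast
  qed
  also have "\<dots> \<in> sets borel"
    by (intro sets.countable_UN'' sets.Int hit Suc countable_rat)
  finally show ?case .
qed

text \<open>Crossings are counted by their parameter \<open>s\<close> on the segment. Each odd count
  is a difference of two Borel conditions, and there are countably many counts.\<close>

lemma borel_odd_crossings:
  fixes A :: "'a::euclidean_space set"
  assumes "fsigma_in euclidean A"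
  shows "{y. odd (card (A \<inter> open_segment z y))} \<in> sets borel"
proof -
  let ?S = "\<lambda>y. {s\<in>{0<..<1::real}. z + s *\<^sub>R (y - z) \<in> A}"
  have "card (A \<inter> open_segment z y) = card (?S y)" for y
  proof (cases "y = z")
    \<comment> \<open>The segment is empty here, while the parameter set is empty or the whole unit
      interval; the latter is infinite, so \<open>card\<close> is 0 either way.\<close>
    case True
    have "?S y = (if z \<in> A then {0<..<1} else {})"
      using True by auto
    then show ?thesis using True by (simp add: infinite_Ioo)
  next
    case False
    have "A \<inter> open_segment z y = (\<lambda>s. z + s *\<^sub>R (y - z)) ` ?S y"
    proof -
      have "open_segment z y = (\<lambda>s. z + s *\<^sub>R (y - z)) ` {0<..<1}"
        using False by (auto simp: open_segment_image_interval algebra_simps)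
      then show ?thesis by auto
    qed
    moreover have "inj_on (\<lambda>s. z + s *\<^sub>R (y - z)) (?S y)"
      using False by (auto intro!: inj_onI)
    ultimately show ?thesis by (simp add: card_image)
  qed
  then have "{y. odd (card (A \<inter> open_segment z y))} = (\<Union>k\<in>{k. odd k}.
      {y. at_least k (?S y \<inter> {0<..})} - {y. at_least (Suc k) (?S y \<inter> {0<..})})"
  proof -
    assume eq: "\<And>y. card (A \<inter> open_segment z y) = card (?S y)"
    have "?S y \<inter> {0<..} = ?S y" for y by auto
    then show ?thesis unfolding eq odd_card_iff_at_least by auto
  qed
  also have "\<dots> \<in> sets borel"
    using borel_at_least_on_ray[OF assms] by (intro sets.countable_UN'' sets.Diff) auto
  finally show ?thesis .
qed

section \<open>Tangents of curves\<close>

lemma has_vector_derivative_imp_slope: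
  assumes "(f has_vector_derivative v) (at x within S)"
  shows "((\<lambda>y. (f y - f x) /\<^sub>R (y - x)) \<longlongrightarrow> v) (at x within S)"
proof -
  have lim: "((\<lambda>y. ((f y - f x) - (y - x) *\<^sub>R v) /\<^sub>R norm (y - x)) \<longlongrightarrow> 0) (at x within S)"
    using assms by (simp add: has_vector_derivative_def has_derivative_at_within)
  have "norm ((f y - f x) /\<^sub>R (y - x) - v) \<le>
      norm (((f y - f x) - (y - x) *\<^sub>R v) /\<^sub>R norm (y - x))" if "y \<noteq> x" for y
  proof -
    have "(f y - f x) /\<^sub>R (y - x) - v = ((f y - f x) - (y - x) *\<^sub>R v) /\<^sub>R (y - x)"
      using that by (simp add: scaleR_diff_right)
    then show ?thesis by simp
  qed
  then have "\<forall>\<^sub>F y in at x within S. norm ((f y - f x) /\<^sub>R (y - x) - v) \<le>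
      norm (((f y - f x) - (y - x) *\<^sub>R v) /\<^sub>R norm (y - x))"
    unfolding eventually_at_filter by (intro always_eventually) blast
  then have "((\<lambda>y. (f y - f x) /\<^sub>R (y - x) - v) \<longlongrightarrow> 0) (at x within S)"
    by (rule Lim_null_comparison[OF _ tendsto_norm_zero[OF lim]])
  then show ?thesis by (simp add: LIM_zero_iff)
qed

text \<open>A motion that stays in \<open>C\<close> only for a short time is replaced by the
  constant \<open>p\<close> from time \<open>\<eta>\<close> on. The jump at \<open>\<eta>\<close> is
  harmless, since only the derivative at 0 counts.\<close>

lemma tangent_vectors_localI:
  assumes "\<eta> > 0" "\<gamma> 0 = p" "\<And>t. 0 \<le> t \<Longrightarrow> t < \<eta> \<Longrightarrow> \<gamma> t \<in> C"
    "(\<gamma> has_vector_derivative v) (at 0 within {0..})"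
  shows "v \<in> tangent_vectors C p"
proof -
  define c where "c t = (if t < \<eta> then \<gamma> t else p)" for t
  have "(c has_vector_derivative v) (at 0 within {0..})"
    using assms(4) by (rule has_vector_derivative_transform_within[OF _ assms(1)])
      (use assms(1) in \<open>auto simp: c_def dist_real_def\<close>)
  moreover have "c t \<in> C" if "t \<ge> 0" for t
    using assms(1,2) assms(3)[of 0] assms(3)[of t] that by (auto simp: c_def)
  ultimately show ?thesis
    unfolding tangent_vectors_def using assms(1,2)
    by (intro CollectI exI[of _ c]) (auto simp: c_def)
qed

text \<open>A motion differentiable at 0 is continuous there, hence stays in \<open>H\<close> for a
  short time.\<close>

lemma tangent_vectors_mono_local:
  assumes "open H" "p \<in> H" "D \<inter> H \<subseteq> D'"
  shows "tangent_vectors D p \<subseteq> tangent_vectors D' p"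
proof
  fix v assume "v \<in> tangent_vectors D p"
  then obtain \<gamma> where \<gamma>: "\<gamma> 0 = p" "\<And>t. t \<ge> 0 \<Longrightarrow> \<gamma> t \<in> D"
    "(\<gamma> has_vector_derivative v) (at 0 within {0..})"
    by (auto simp: tangent_vectors_def)
  have "(\<gamma> \<longlongrightarrow> p) (at 0 within {0..})"
    using has_vector_derivative_continuous[OF \<gamma>(3)] \<gamma>(1) by (simp add: continuous_within)
  then have "\<forall>\<^sub>F t in at 0 within {0..}. \<gamma> t \<in> H"
    using assms topological_tendstoD by blast
  then obtain \<eta> where \<eta>: "\<eta> > 0" "\<And>t. t \<ge> 0 \<Longrightarrow> t \<noteq> 0 \<Longrightarrow> t < \<eta> \<Longrightarrow> \<gamma> t \<in> H"
    by (auto simp: eventually_at dist_real_def)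
  have "\<gamma> t \<in> D'" if "0 \<le> t" "t < \<eta>" for t
    using that \<eta> \<gamma> assms by (cases "t = 0") auto
  then show "v \<in> tangent_vectors D' p"
    by (intro tangent_vectors_localI[OF \<eta>(1) \<gamma>(1) _ \<gamma>(3)])
qed

text \<open>Crossings and tangents are both determined near the segment. This is what lets a
  half-plane see only its own part of the curve.\<close>

lemma odd_pairs_local:
  assumes "open H" "open_segment x y \<subseteq> H" "D \<inter> H = D' \<inter> H"
  shows "(x, y) \<in> odd_pairs D \<longleftrightarrow> (x, y) \<in> odd_pairs D'"
proof -
  have "tangent_vectors D p = tangent_vectors D' p" if "p \<in> H" for p
    using tangent_vectors_mono_local[OF assms(1) that] assms(3) by blast
  moreover have eq: "open_segment x y \<inter> D = open_segment x y \<inter> D'"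
    using assms by blast
  ultimately have "transversal x y D \<longleftrightarrow> transversal x y D'"
    unfolding transversal_def using assms(2) by blast
  then show ?thesis
    unfolding odd_pairs_def using eq by (simp add: Int_commute)
qed

text \<open>The equality case of Cauchy-Schwarz expresses parallelism as an equation between
  continuous functions, which is stable under limits and defines closed sets.\<close>

lemma in_span_singleton_iff:
  fixes v w :: "'a::euclidean_space"
  assumes "w \<noteq> 0"
  shows "v \<in> span {w} \<longleftrightarrow> \<bar>v \<bullet> w\<bar> = norm v * norm w"
proof -
  have "v \<in> span {w} \<longleftrightarrow> collinear {0, w, v}"
    using assms by (auto simp: span_singleton collinear_lemma)
  also have "\<dots> \<longleftrightarrow> \<bar>w \<bullet> v\<bar> = norm w * norm v"
    by (simp only: norm_cauchy_schwarz_equal)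
  finally show ?thesis
    by (simp add: inner_commute mult.commute)
qed

text \<open>Both kinds of parameter interval are open on the right, so moving forward from
  \<open>t\<close> stays in the chart for time \<open>1 - t\<close>, even at a boundary
  point.\<close>

lemma chart_derivative_tangent:
  assumes "I = {-1<..<1} \<or> I = {0..<1}" "\<gamma> ` I \<subseteq> C" "t \<in> I"
    "(\<gamma> has_vector_derivative d) (at t)"
  shows "d \<in> tangent_vectors C (\<gamma> t)"
proof (rule tangent_vectors_localI)
  show "0 < 1 - t" using assms by auto
  show "\<gamma> (t + s) \<in> C" if "0 \<le> s" "s < 1 - t" for s
    using that assms by auto
  have "((\<lambda>s. t + s) has_real_derivative 1) (at 0)"
    by (auto intro!: derivative_eq_intros)
  then have "((\<gamma> \<circ> (\<lambda>s. t + s)) has_vector_derivative 1 *\<^sub>R d) (at 0)"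
    by (intro vector_diff_chain_at) (use assms in \<open>auto simp: has_real_derivative_iff_has_vector_derivative\<close>)
  then show "((\<lambda>s. \<gamma> (t + s)) has_vector_derivative d) (at 0 within {0..})"
    by (simp add: o_def has_vector_derivative_at_within)
qed simp

text \<open>Both \<open>v\<close> and \<open>d\<close> are limits of parallel difference quotients, so equality in Cauchy-Schwarz
  passes to the limit.\<close>

lemma tangent_in_span_chart_derivative:
  assumes "open U" "homeomorphism I (C \<inter> U) \<gamma> g" "t \<in> I"
    and \<gamma>': "(\<gamma> has_vector_derivative d) (at t)" and "d \<noteq> 0"
    and "v \<in> tangent_vectors C (\<gamma> t)"
  shows "v \<in> span {d}"
proof -
  obtain c where c: "c 0 = \<gamma> t" "\<And>s. s \<ge> 0 \<Longrightarrow> c s \<in> C"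
    "(c has_vector_derivative v) (at 0 within {0..})"
    using assms(6) by (auto simp: tangent_vectors_def)
  have p: "\<gamma> t \<in> C \<inter> U" and gt: "g (\<gamma> t) = t"
    using assms(2,3) by (auto simp: homeomorphism_def)
  have c_lim: "(c \<longlongrightarrow> \<gamma> t) (at 0 within {0..})"
    using has_vector_derivative_continuous[OF c(3)] c(1) by (simp add: continuous_within)
  have "\<forall>\<^sub>F s in at 0 within {0..}. c s \<in> U"
    using topological_tendstoD[OF c_lim assms(1)] p by blast
  moreover have "\<forall>\<^sub>F s in at 0 within {0..}. s \<in> {0..} \<and> s \<noteq> (0::real)"
    by (auto simp: eventually_at_filter)
  ultimately have ev: "\<forall>\<^sub>F s in at 0 within {0..}. c s \<in> C \<inter> U \<and> s > 0"
    by eventually_elim (use c(2) in auto)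
  \<comment> \<open>The difference quotient is extended continuously by \<open>d\<close>. Then
    \<open>h (g (c s))\<close> tends to \<open>d\<close> even if \<open>g (c s)\<close> equals
    \<open>t\<close> for some \<open>s\<close>, and only continuity of \<open>g\<close>
    enters.\<close>
  define h where "h s = (if s = t then d else (\<gamma> s - \<gamma> t) /\<^sub>R (s - t))" for s
  have h_eq: "\<gamma> s - \<gamma> t = (s - t) *\<^sub>R h s" for s
    by (simp add: h_def)
  have "(h \<longlongrightarrow> d) (at t)"
    using has_vector_derivative_imp_slope[OF \<gamma>']
    by (rule tendsto_cong[THEN iffD1, rotated]) (auto simp: h_def eventually_at_filter)
  then have "isCont h t"
    by (simp add: isCont_def h_def)
  moreover have "((\<lambda>s. g (c s)) \<longlongrightarrow> g (\<gamma> t)) (at 0 within {0..})"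
  proof (rule continuous_on_tendsto_compose[OF _ c_lim p])
    show "continuous_on (C \<inter> U) g" using assms(2) by (simp add: homeomorphism_def)
    show "\<forall>\<^sub>F s in at 0 within {0..}. c s \<in> C \<inter> U" using ev by eventually_elim simp
  qed
  ultimately have h_lim: "((\<lambda>s. h (g (c s))) \<longlongrightarrow> d) (at 0 within {0..})"
    using isCont_tendsto_compose[of t h] gt by (fastforce simp: h_def)
  have v_lim: "((\<lambda>s. (c s - c 0) /\<^sub>R (s - 0)) \<longlongrightarrow> v) (at 0 within {0..})"
    by (rule has_vector_derivative_imp_slope[OF c(3)])
  let ?\<Delta> = "\<lambda>s. \<bar>((c s - c 0) /\<^sub>R (s - 0)) \<bullet> h (g (c s))\<bar> - norm ((c s - c 0) /\<^sub>R (s - 0)) * norm (h (g (c s)))"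
  have lim: "(?\<Delta> \<longlongrightarrow> \<bar>v \<bullet> d\<bar> - norm v * norm d) (at 0 within {0..})"
    by (intro tendsto_intros v_lim h_lim)
  have zero: "\<forall>\<^sub>F s in at 0 within {0..}. ?\<Delta> s = 0"
    using ev
  proof eventually_elim
    fix s assume s: "c s \<in> C \<inter> U \<and> s > 0"
    have "c s = \<gamma> (g (c s))"
      using assms(2) s by (auto simp: homeomorphism_def)
    \<comment> \<open>The increment of \<open>c\<close> is a real multiple of
      \<open>h (g (c s))\<close>, so Cauchy-Schwarz is an equality before the limit is
      taken.\<close>
    then have "c s - c 0 = (g (c s) - t) *\<^sub>R h (g (c s))"
      using h_eq[of "g (c s)"] c(1) by simp
    then show "?\<Delta> s = 0"
      by (simp add: abs_mult power2_norm_eq_inner[symmetric] power2_eq_square)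
  qed
  have "((\<lambda>s::real. 0::real) \<longlongrightarrow> \<bar>v \<bullet> d\<bar> - norm v * norm d) (at 0 within {0..})"
    by (rule iffD1[OF tendsto_cong[OF zero] lim])
  moreover have "\<not> trivial_limit (at 0 within {0::real..})"
    by (simp add: at_within_Ici_at_right)
  ultimately have "\<bar>v \<bullet> d\<bar> - norm v * norm d = 0"
    using tendsto_unique[OF _ _ tendsto_const] by fastforce
  then show ?thesis
    using in_span_singleton_iff[OF assms(5)] by simp
qed

text \<open>The chart derivative is itself a tangent vector and spans all the others, so it alone
  decides whether some nonzero tangent points along the ray from \<open>z\<close>. The quantifier
  over motions thereby becomes an equation in \<open>t\<close>.\<close>

lemma pointing_tangents_in_chart:
  fixes C :: "(real^2) set"
  assumes "open U" and I: "I = {-1<..<1} \<or> I = {0..<1}"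
    and \<gamma>: "\<gamma> C1_differentiable_on I" "\<forall>t\<in>I. vector_derivative \<gamma> (at t) \<noteq> 0"
    and hom: "homeomorphism I (C \<inter> U) \<gamma> g"
  shows "{p\<in>C. p \<noteq> z \<and> (\<exists>v\<in>tangent_vectors C p. v \<noteq> 0 \<and> v \<in> span {p - z})} \<inter> U =
    \<gamma> ` {t\<in>I. \<gamma> t \<noteq> z \<and> \<bar>vector_derivative \<gamma> (at t) \<bullet> (\<gamma> t - z)\<bar> =
      norm (vector_derivative \<gamma> (at t)) * norm (\<gamma> t - z)}"
    (is "?B \<inter> U = \<gamma> ` ?T")
proof -
  have im: "C \<inter> U = \<gamma> ` I"
    using hom by (simp add: homeomorphism_def)
  have "(\<exists>v\<in>tangent_vectors C (\<gamma> t). v \<noteq> 0 \<and> v \<in> span {\<gamma> t - z}) \<longleftrightarrow>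
      \<bar>vector_derivative \<gamma> (at t) \<bullet> (\<gamma> t - z)\<bar> = norm (vector_derivative \<gamma> (at t)) * norm (\<gamma> t - z)"
    if t: "t \<in> I" "\<gamma> t \<noteq> z" for t
  proof -
    let ?d = "vector_derivative \<gamma> (at t)"
    have d: "(\<gamma> has_vector_derivative ?d) (at t)"
      using \<gamma>(1) t(1) by (auto simp: C1_differentiable_on_eq vector_derivative_works)
    have "?d \<in> tangent_vectors C (\<gamma> t)"
      by (rule chart_derivative_tangent[OF I _ t(1) d]) (use im in auto)
    moreover have "?d \<in> span {\<gamma> t - z}"
      if "v \<in> tangent_vectors C (\<gamma> t)" "v \<noteq> 0" "v \<in> span {\<gamma> t - z}" for v
    proof -
      have "v \<in> span {?d}"
        by (rule tangent_in_span_chart_derivative[OF assms(1) hom t(1) d bspec[OF \<gamma>(2) t(1)] that(1)])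
      then obtain k where k: "v = k *\<^sub>R ?d"
        by (auto simp: span_singleton)
      with that(2) have "?d = inverse k *\<^sub>R v"
        by auto
      then show ?thesis
        using that(3) by (simp add: span_mul)
    qed
    ultimately have "(\<exists>v\<in>tangent_vectors C (\<gamma> t). v \<noteq> 0 \<and> v \<in> span {\<gamma> t - z}) \<longleftrightarrow> ?d \<in> span {\<gamma> t - z}"
      using \<gamma>(2) t(1) by blast
    then show ?thesis
      using in_span_singleton_iff[of "\<gamma> t - z" ?d] t(2) by simp
  qed
  then have *: "\<gamma> t \<in> ?B \<longleftrightarrow> t \<in> ?T" if "t \<in> I" for t
    using that im by auto
  have "?B \<inter> U = ?B \<inter> \<gamma> ` I"
    using im by blast
  also have "\<dots> = \<gamma> ` ?T"
  proof (intro equalityI subsetI)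
    fix p assume "p \<in> ?B \<inter> \<gamma> ` I"
    then obtain t where "t \<in> I" "p = \<gamma> t" "\<gamma> t \<in> ?B" by blast
    then show "p \<in> \<gamma> ` ?T" using * by blast
  next
    fix p assume "p \<in> \<gamma> ` ?T"
    then obtain t where "p = \<gamma> t" "t \<in> ?T" by blast
    then show "p \<in> ?B \<inter> \<gamma> ` I" using *[of t] by blast
  qed
  finally show ?thesis .
qed

section \<open>Borel measurability of the odd-crossing condition\<close>

lemma fsigma_chart_domain:
  assumes "I = {-1<..<1::real} \<or> I = {0..<1}"
  shows "fsigma_in euclidean I"
proof -
  have "fsigma_in euclidean ({0..} \<inter> {..<1::real})"
    by (intro fsigma_in_Int open_imp_fsigma_euclidean[OF open_lessThan] closed_imp_fsigma_in) auto
  moreover have "{0..} \<inter> {..<1::real} = {0..<1}" by auto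
  moreover have "fsigma_in euclidean {-1<..<1::real}"
    by (intro open_imp_fsigma_euclidean) auto
  ultimately show ?thesis
    using assms by auto
qed

lemma C1_curve_chart:
  assumes "C1_curve C" "p \<in> C"
  obtains U I \<gamma> g where "open U" "p \<in> U" "I = {-1<..<1::real} \<or> I = {0..<1}"
    "\<gamma> C1_differentiable_on I" "\<forall>t\<in>I. vector_derivative \<gamma> (at t) \<noteq> 0"
    "homeomorphism I (C \<inter> U) \<gamma> g"
  using bspec[OF assms(1)[unfolded C1_curve_def] assms(2)] by (elim exE conjE) (rule that)

lemma C1_curve_fsigma:
  assumes "C1_curve C"
  shows "fsigma_in euclidean C"
proof (rule fsigma_in_locally)
  fix p assume "p \<in> C"
  then obtain U I \<gamma> g where *: "open U" "p \<in> U" "I = {-1<..<1::real} \<or> I = {0..<1}"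
    "homeomorphism I (C \<inter> U) \<gamma> g"
    by (rule C1_curve_chart[OF assms])
  have "fsigma_in euclidean (\<gamma> ` I)"
    by (rule fsigma_in_continuous_image[OF _ fsigma_chart_domain[OF *(3)]])
      (use *(4) in \<open>simp add: homeomorphism_def\<close>)
  moreover have "\<gamma> ` I = C \<inter> U"
    using *(4) by (simp add: homeomorphism_def)
  ultimately have "fsigma_in euclidean (C \<inter> U)"
    by (simp only:)
  with *(1,2) show "\<exists>U. open U \<and> p \<in> U \<and> fsigma_in euclidean (C \<inter> U)"
    by (intro exI conjI)
qed

text \<open>In a chart the tangency equation is relatively closed, because the derivative is
  continuous, and avoiding \<open>z\<close> is relatively open. The parameter set is thus F-sigma,
  and so is its image.\<close>

lemma pointing_tangents_fsigma:
  assumes "C1_curve C"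
  shows "fsigma_in euclidean
    {p\<in>C. p \<noteq> z \<and> (\<exists>v\<in>tangent_vectors C p. v \<noteq> 0 \<and> v \<in> span {p - z})}" (is "fsigma_in _ ?B")
proof (rule fsigma_in_locally)
  fix p assume "p \<in> ?B"
  then have "p \<in> C" by simp
  then obtain U I \<gamma> g where *: "open U" "p \<in> U" "I = {-1<..<1::real} \<or> I = {0..<1}"
    "\<gamma> C1_differentiable_on I" "\<forall>t\<in>I. vector_derivative \<gamma> (at t) \<noteq> 0"
    "homeomorphism I (C \<inter> U) \<gamma> g"
    by (rule C1_curve_chart[OF assms])
  let ?d = "\<lambda>t. vector_derivative \<gamma> (at t)"
  define f where "f t = \<bar>?d t \<bullet> (\<gamma> t - z)\<bar> - norm (?d t) * norm (\<gamma> t - z)" for t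
  have cont: "continuous_on I \<gamma>" "continuous_on I ?d"
    using *(4,6) by (auto simp: homeomorphism_def C1_differentiable_on_eq)
  then have "continuous_on I f"
    unfolding f_def by (intro continuous_intros)
  \<comment> \<open>\<open>I\<close> need not be closed, so the zero set is only the trace on
    \<open>I\<close> of a closed set.\<close>
  then obtain K where K: "closed K" "I \<inter> f -` {0} = I \<inter> K"
    using continuous_closedin_preimage[of I f "{0}"] by (auto simp: closedin_closed)
  obtain V where V: "open V" "I \<inter> \<gamma> -` (- {z}) = I \<inter> V"
    using continuous_openin_preimage_gen[OF cont(1), of "- {z}"] by (auto simp: openin_open)
  have "{t\<in>I. \<gamma> t \<noteq> z \<and> f t = 0} = I \<inter> K \<inter> V"
    using K(2) V(2) by blast
  also have "fsigma_in euclidean \<dots>"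
    by (intro fsigma_in_Int fsigma_chart_domain[OF *(3)] open_imp_fsigma_euclidean[OF V(1)]
        closed_imp_fsigma_in) (simp add: K(1))
  finally have "fsigma_in euclidean (\<gamma> ` {t\<in>I. \<gamma> t \<noteq> z \<and> f t = 0})"
    by (intro fsigma_in_continuous_image) (auto intro: continuous_on_subset[OF cont(1)])
  moreover have "?B \<inter> U = \<gamma> ` {t\<in>I. \<gamma> t \<noteq> z \<and> f t = 0}"
    unfolding f_def right_minus_eq by (rule pointing_tangents_in_chart[OF *(1,3,4,5,6)])
  ultimately have "fsigma_in euclidean (?B \<inter> U)"
    by (simp only:)
  with *(1,2) show "\<exists>U. open U \<and> p \<in> U \<and> fsigma_in euclidean (?B \<inter> U)"
    by (intro exI conjI)
qed

text \<open>Transversality fails exactly when the segment hits the bad set \<open>?B\<close>, which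
  does not depend on \<open>y\<close>. Such \<open>y\<close> form a ray preimage, and this is
  removed from the Borel set of odd crossing counts.\<close>

lemma borel_odd_pairs:
  assumes "C1_curve C"
  shows "{y. (z, y) \<in> odd_pairs C} \<in> sets borel"
proof -
  let ?B = "{p\<in>C. p \<noteq> z \<and> (\<exists>v\<in>tangent_vectors C p. v \<noteq> 0 \<and> v \<in> span {p - z})}"
  let ?N = "{y. \<exists>s\<in>{0<..<1}. z + s *\<^sub>R (y - z) \<in> ?B}"
  have "transversal z y C \<longleftrightarrow> y \<notin> ?N" for y
  proof (cases "y = z")
    \<comment> \<open>The segment is empty, and \<open>z\<close> is not in \<open>?N\<close> because
      \<open>?B\<close> excludes \<open>z\<close>.\<close>
    case True
    then show ?thesis by (auto simp: transversal_def)
  next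
    case False
    have seg: "open_segment z y = (\<lambda>s. z + s *\<^sub>R (y - z)) ` {0<..<1}"
      using False by (auto simp: open_segment_image_interval algebra_simps)
    \<comment> \<open>A point of the segment differs from \<open>z\<close> by a nonzero multiple of
      \<open>y - z\<close>, so the direction \<open>p - z\<close> used in \<open>?B\<close> is that
      of the segment.\<close>
    have span: "span {s *\<^sub>R (y - z)} = span {y - z}" if "s \<noteq> 0" for s
    proof -
      have "inverse s *\<^sub>R s *\<^sub>R (y - z) \<in> span {s *\<^sub>R (y - z)}"
        by (intro span_mul span_base) simp
      then have "y - z \<in> span {s *\<^sub>R (y - z)}"
        using that by simp
      moreover have "s *\<^sub>R (y - z) \<in> span {y - z}"
        by (intro span_mul span_base) simp
      ultimately show ?thesis
        by (intro equalityI span_minimal) auto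
    qed
    have "transversal z y C \<longleftrightarrow> (\<forall>s\<in>{0<..<1}. z + s *\<^sub>R (y - z) \<in> C \<longrightarrow>
        (\<forall>v\<in>tangent_vectors C (z + s *\<^sub>R (y - z)). v \<noteq> 0 \<longrightarrow> v \<notin> span {y - z}))"
      unfolding transversal_def seg by blast
    also have "\<dots> \<longleftrightarrow> (\<forall>s\<in>{0<..<1}. z + s *\<^sub>R (y - z) \<notin> ?B)"
    proof (intro ball_cong refl)
      fix s :: real assume "s \<in> {0<..<1}"
      then have s: "s \<noteq> 0" by auto
      let ?p = "z + s *\<^sub>R (y - z)"
      have "?p \<noteq> z" "span {?p - z} = span {y - z}"
        using False span[OF s] s by simp_all
      then show "(?p \<in> C \<longrightarrow> (\<forall>v\<in>tangent_vectors C ?p. v \<noteq> 0 \<longrightarrow> v \<notin> span {y - z})) \<longleftrightarrow> ?p \<notin> ?B"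
        by auto
    qed
    also have "\<dots> \<longleftrightarrow> y \<notin> ?N"
      by blast
    finally show ?thesis .
  qed
  then have "{y. (z, y) \<in> odd_pairs C} = {y. odd (card (C \<inter> open_segment z y))} - ?N"
    by (auto simp: odd_pairs_def)
  also have "\<dots> \<in> sets borel"
    by (intro sets.Diff borel_odd_crossings C1_curve_fsigma[OF assms] fsigma_in_imp_borel
        fsigma_in_ray_preimage pointing_tangents_fsigma[OF assms] open_imp_fsigma_euclidean[OF open_greaterThanLessThan]) auto
  finally show ?thesis .
qed

section \<open>Splitting the integral\<close>

text \<open>On the line through \<open>z\<close> orthogonal to \<open>u\<close> neither region
  contains \<open>y\<close>, which agrees with \<open>sgn 0 = 0\<close>. Off the line an odd
  crossing count reverses the sign.\<close>

lemma chi_hat_eq: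
  "chi_hat C u z y = (if (z, y) \<in> odd_pairs C then sgn ((y - z) \<bullet> u) else sgn ((z - y) \<bullet> u))"
  by (auto simp: chi_hat_def interior_set_def exterior_set_def inner_diff_left)

lemma chi_hat_measurable:
  assumes "C1_curve C"
  shows "chi_hat C u z \<in> borel_measurable borel"
proof -
  have [measurable]: "{y. (z, y) \<in> odd_pairs C} \<in> sets borel"
    by (rule borel_odd_pairs[OF assms])
  have "(\<lambda>y. if y \<in> {y. (z, y) \<in> odd_pairs C} then sgn ((y - z) \<bullet> u) else sgn ((z - y) \<bullet> u))
      \<in> borel_measurable borel"
    by measurable
  then show ?thesis
    unfolding chi_hat_eq[abs_def] by simp
qed

lemma open_segment_in_halfspace:
  fixes z u :: "'a::real_inner"
  assumes "(y - z) \<bullet> u > 0"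
  shows "open_segment z y \<subseteq> {p. (p - z) \<bullet> u > 0}"
proof
  fix p assume "p \<in> open_segment z y"
  then obtain s where s: "0 < s" "p = (1 - s) *\<^sub>R z + s *\<^sub>R y"
    by (auto simp: in_segment)
  then have "p - z = s *\<^sub>R (y - z)"
    by (simp add: algebra_simps)
  then show "p \<in> {p. (p - z) \<bullet> u > 0}"
    using s assms by simp
qed

lemma odd_pairs_halfspace:
  assumes "(y - z) \<bullet> u > 0" "D \<inter> {p. (p - z) \<bullet> u > 0} = D' \<inter> {p. (p - z) \<bullet> u > 0}"
  shows "(z, y) \<in> odd_pairs D \<longleftrightarrow> (z, y) \<in> odd_pairs D'"
proof (rule odd_pairs_local[OF _ open_segment_in_halfspace[OF assms(1)] assms(2)])
  have "{p. (p - z) \<bullet> u > 0} = {p. u \<bullet> p > u \<bullet> z}"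
    by (auto simp: inner_diff_left inner_commute[of u])
  then show "open {p. (p - z) \<bullet> u > 0}"
    by (simp add: open_halfspace_gt)
qed

text \<open>Rescaling \<open>u\<close> by \<open>(y - z) \<bullet> u\<close> puts \<open>y\<close>
  on the positive side in either case, so both half-planes are handled at once.\<close>

lemma odd_pairs_off_line:
  assumes "(y - z) \<bullet> u \<noteq> 0"
    and "\<And>p. (p - z) \<bullet> u * ((y - z) \<bullet> u) > 0 \<Longrightarrow> p \<in> D \<longleftrightarrow> p \<in> D'"
  shows "(z, y) \<in> odd_pairs D \<longleftrightarrow> (z, y) \<in> odd_pairs D'"
proof (rule odd_pairs_halfspace[of _ _ "((y - z) \<bullet> u) *\<^sub>R u"])
  show "(y - z) \<bullet> ((y - z) \<bullet> u) *\<^sub>R u > 0"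
    using assms(1) by (simp add: zero_less_mult_iff) linarith
qed (use assms(2) in \<open>auto simp: mult.commute\<close>)

lemma odd_pairs_empty: "(x, y) \<notin> odd_pairs {}"
  by (simp add: odd_pairs_def)

lemma chi_hat_off_line:
  assumes "\<And>p. (p - z) \<bullet> u \<noteq> 0 \<Longrightarrow> p \<in> D \<longleftrightarrow> p \<in> D'"
  shows "chi_hat D u z = chi_hat D' u z"
proof
  fix y
  show "chi_hat D u z y = chi_hat D' u z y"
  proof (cases "(y - z) \<bullet> u = 0")
    case True
    then show ?thesis by (simp add: chi_hat_eq inner_diff_left)
  next
    case False
    then have "(z, y) \<in> odd_pairs D \<longleftrightarrow> (z, y) \<in> odd_pairs D'"
      by (rule odd_pairs_off_line) (rule assms, auto)
    then show ?thesis by (simp add: chi_hat_eq)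
  qed
qed

text \<open>The sign \<open>s\<close> selects the side. From the opposite side \<open>D\<close> is
  invisible, as if it were empty, and an empty set gives an even crossing count.\<close>

lemma chi_hat_halfplane:
  assumes "\<bar>s\<bar> = 1" and D: "D = C \<inter> {p. (p - z) \<bullet> u * s > 0}"
  shows "chi_hat D u z y = (if (y - z) \<bullet> u * s > 0 then chi_hat C u z y else sgn ((z - y) \<bullet> u))"
proof (cases "(y - z) \<bullet> u = 0")
  case True
  then show ?thesis by (simp add: chi_hat_eq inner_diff_left)
next
  case nz: False
  show ?thesis
  proof (cases "(y - z) \<bullet> u * s > 0")
    case True
    have "(z, y) \<in> odd_pairs D \<longleftrightarrow> (z, y) \<in> odd_pairs C"
      by (rule odd_pairs_off_line[OF nz]) (use True in \<open>auto simp: D zero_less_mult_iff\<close>)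
    then show ?thesis using True by (simp add: chi_hat_eq)
  next
    case False
    have "(z, y) \<in> odd_pairs D \<longleftrightarrow> (z, y) \<in> odd_pairs {}"
      by (rule odd_pairs_off_line[OF nz]) (use False in \<open>auto simp: D zero_less_mult_iff\<close>)
    then show ?thesis using False by (simp add: chi_hat_eq odd_pairs_empty)
  qed
qed

text \<open>The kernel is dominated on dyadic shells by a geometric series of ratio \<open>2 powr (DIM('a) - a)\<close>.\<close>

lemma powr_tail_integrable:
  fixes z :: "'a::euclidean_space" and a :: real
  assumes "\<epsilon> > 0" "a > DIM('a)"
  shows "set_integrable lborel (- ball z \<epsilon>) (\<lambda>y. 1 / norm (z - y) powr a)"
proof -
  \<comment> \<open>\<open>c n\<close> bounds the kernel on the shell of radii from
    \<open>2 ^ n * \<epsilon>\<close> to \<open>2 ^ Suc n * \<epsilon>\<close>. Multiplied by the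
    volume of the larger ball it becomes \<open>V * q ^ n\<close>.\<close>
  define c where "c n = (2 ^ n * \<epsilon>) powr - a" for n :: nat
  define V where "V = unit_ball_vol (DIM('a)) * (2 * \<epsilon>) ^ DIM('a) * \<epsilon> powr - a"
  define q where "q = 2 powr (DIM('a) - a)"
  have le: "ennreal (indicator (- ball z \<epsilon>) y *\<^sub>R (1 / norm (z - y) powr a))
      \<le> (\<Sum>n. ennreal (c n) * indicator (ball z (2 ^ Suc n * \<epsilon>)) y)" for y
  proof (cases "y \<in> ball z \<epsilon>")
    case False
    define r where "r = norm (z - y)"
    have r: "r \<ge> \<epsilon>" using False by (simp add: r_def dist_norm)
    \<comment> \<open>The index of the shell that contains \<open>y\<close>; its term alone already
      dominates the kernel at \<open>y\<close>.\<close>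
    define n where "n = nat \<lfloor>log 2 (r / \<epsilon>)\<rfloor>"
    have "0 \<le> log 2 (r / \<epsilon>)" using r assms by simp
    then have "real n \<le> log 2 (r / \<epsilon>)" "log 2 (r / \<epsilon>) < real n + 1"
      unfolding n_def by linarith+
    then have "2 powr real n \<le> r / \<epsilon>" "r / \<epsilon> < 2 powr (real n + 1)"
      using r assms by (simp_all add: le_log_iff log_less_iff)
    then have n: "2 ^ n * \<epsilon> \<le> r" "r < 2 ^ Suc n * \<epsilon>"
      using assms by (simp_all add: powr_realpow powr_add field_simps)
    have "1 / r powr a \<le> c n"
      unfolding c_def powr_minus_divide using n assms
      by (intro divide_left_mono powr_mono2 mult_pos_pos) (auto intro!: less_le_trans[OF _ n(1)])
    then have "ennreal (1 / r powr a) \<le> ennreal (c n) * indicator (ball z (2 ^ Suc n * \<epsilon>)) y"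
      using n(2) by (simp add: r_def dist_norm ennreal_leI)
    also have "\<dots> \<le> (\<Sum>n. ennreal (c n) * indicator (ball z (2 ^ Suc n * \<epsilon>)) y)"
      using sum_le_suminf[of "\<lambda>n. ennreal (c n) * indicator (ball z (2 ^ Suc n * \<epsilon>)) y" "{n}"]
      by (simp del: sum_mult_indicator mem_ball power_Suc)
    finally show ?thesis using False by (simp add: r_def)
  qed simp
  have "(\<integral>\<^sup>+y. ennreal (indicator (- ball z \<epsilon>) y *\<^sub>R (1 / norm (z - y) powr a)) \<partial>lborel)
      \<le> (\<integral>\<^sup>+y. (\<Sum>n. ennreal (c n) * indicator (ball z (2 ^ Suc n * \<epsilon>)) y) \<partial>lborel)"
    by (intro nn_integral_mono le)
  also have "\<dots> = (\<Sum>n. ennreal (c n) * emeasure lborel (ball z (2 ^ Suc n * \<epsilon>)))"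
    by (subst nn_integral_suminf)
      (auto simp: nn_integral_cmult_indicator intro!: borel_measurable_times_ennreal borel_measurable_indicator)
  also have "\<dots> = (\<Sum>n. ennreal (V * q ^ n))"
  proof (intro suminf_cong)
    fix n
    have "c n * (2 ^ Suc n * \<epsilon>) ^ DIM('a) = (2 * \<epsilon>) ^ DIM('a) * \<epsilon> powr - a * q ^ n"
    proof -
      have "q ^ n = (2 ^ n) powr (DIM('a) - a)"
        unfolding q_def by (simp add: powr_realpow[symmetric] powr_powr mult.commute)
      also have "\<dots> = (2 ^ n) ^ DIM('a) * (2 ^ n) powr - a"
        by (simp add: powr_diff powr_minus_divide powr_realpow)
      finally show ?thesis
        using assms by (simp add: c_def powr_mult power_mult_distrib mult_ac)
    qed
    then show "ennreal (c n) * emeasure lborel (ball z (2 ^ Suc n * \<epsilon>)) = ennreal (V * q ^ n)"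
      using assms by (simp add: emeasure_ball ennreal_mult'[symmetric] V_def mult_ac c_def)
  qed
  also have "\<dots> < \<infinity>"
  proof -
    have "0 < q" "q < 1" using assms by (auto simp: q_def powr_less_one)
    then have "summable (\<lambda>n. V * q ^ n)"
      by (intro summable_mult summable_geometric) auto
    moreover have "V * q ^ n \<ge> 0" for n
      using assms \<open>0 < q\<close> by (simp add: V_def)
    ultimately show ?thesis
      by (simp add: suminf_ennreal2)
  qed
  finally show ?thesis
    unfolding set_integrable_def by (intro integrableI_nonneg) auto
qed

text \<open>Point reflection at \<open>z\<close> preserves Lebesgue measure, so the integral equals
  its own negative.\<close>

lemma reflection_odd_integral:
  fixes z :: "'a::euclidean_space" and f :: "'a \<Rightarrow> real"
  assumes "\<And>y. f (2 *\<^sub>R z - y) = - f y" and [measurable]: "f \<in> borel_measurable borel"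
  shows "integral\<^sup>L lborel f = 0"
proof -
  have "distr lborel borel (\<lambda>y. 2 *\<^sub>R z + (-1) *\<^sub>R y) = (lborel :: 'a measure)"
    using lborel_affine[of "-1" "2 *\<^sub>R z"] by (simp add: density_1)
  then have "integral\<^sup>L lborel f = integral\<^sup>L (distr lborel borel (\<lambda>y. 2 *\<^sub>R z + (-1) *\<^sub>R y)) f"
    by simp
  also have "\<dots> = (\<integral>y. f (2 *\<^sub>R z + (-1) *\<^sub>R y) \<partial>lborel)"
    by (intro integral_distr) auto
  also have "\<dots> = - integral\<^sup>L lborel f"
    using assms(1) by simp
  finally show ?thesis by simp
qed

text \<open>The exponent exceeds the dimension 2 of the plane, and the removed ball contains the
  singularity.\<close>

lemma kernel_integrable:
  fixes f :: "real^2 \<Rightarrow> real"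
  assumes "\<sigma> > 0" "\<epsilon> > 0" "f \<in> borel_measurable borel" "\<And>y. \<bar>f y\<bar> \<le> 1"
  shows "set_integrable lborel (- ball z \<epsilon>) (\<lambda>y. f y / norm (z - y) powr (2 + \<sigma>))"
proof (rule set_integrable_bound)
  show "set_integrable lborel (- ball z \<epsilon>) (\<lambda>y. 1 / norm (z - y) powr (2 + \<sigma>))"
    by (rule powr_tail_integrable) (use assms in auto)
  show "set_borel_measurable lborel (- ball z \<epsilon>) (\<lambda>y. f y / norm (z - y) powr (2 + \<sigma>))"
    unfolding set_borel_measurable_def using assms(3) by measurable
  show "AE y in lborel. y \<in> - ball z \<epsilon> \<longrightarrow>
      norm (f y / norm (z - y) powr (2 + \<sigma>)) \<le> norm (1 / norm (z - y) powr (2 + \<sigma>))"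
    using assms(4) by (intro AE_I2) (auto intro: divide_right_mono)
qed

lemma halfplane_integral_zero:
  "(LINT y : - ball z \<epsilon> | lborel. sgn ((y - z) \<bullet> u) / norm (z - y) powr a) = 0"
  unfolding set_lebesgue_integral_def
proof (rule reflection_odd_integral[of _ z])
  fix y
  have "dist z (2 *\<^sub>R z - y) = dist z y" "norm (z - (2 *\<^sub>R z - y)) = norm (z - y)"
    "2 *\<^sub>R z - y - z = - (y - z)"
    by (simp_all add: dist_norm norm_minus_commute scaleR_2)
  then show "indicat_real (- ball z \<epsilon>) (2 *\<^sub>R z - y) *\<^sub>R
      (sgn ((2 *\<^sub>R z - y - z) \<bullet> u) / norm (z - (2 *\<^sub>R z - y)) powr a) =
      - (indicat_real (- ball z \<epsilon>) y *\<^sub>R (sgn ((y - z) \<bullet> u) / norm (z - y) powr a))"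
    by (simp only: inner_minus_left sgn_minus indicator_def Compl_iff mem_ball) simp
qed measurable

section \<open>Additivity of the truncated curvature and passage to the limit\<close>

lemma abs_chi_hat_le_1: "\<bar>chi_hat C u z y\<bar> \<le> 1"
  by (simp add: chi_hat_def)

lemma truncated_curvature_split:
  assumes "C1_curve C" "\<sigma> > 0" "\<epsilon> > 0"
  shows "truncated_curvature \<sigma> z C u \<epsilon> =
    truncated_curvature \<sigma> z (C \<inter> {p. (p - z) \<bullet> u > 0}) u \<epsilon> +
    truncated_curvature \<sigma> z (C \<inter> {p. (p - z) \<bullet> u < 0}) u \<epsilon>"
proof -
  let ?k = "\<lambda>y. norm (z - y) powr (2 + \<sigma>)"
  let ?I = "\<lambda>f. LINT y : - ball z \<epsilon> | lborel. f y / ?k y"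
  let ?P = "chi_hat (C \<inter> {p. (p - z) \<bullet> u > 0}) u z"
  let ?M = "chi_hat (C \<inter> {p. (p - z) \<bullet> u < 0}) u z"
  let ?S = "\<lambda>y. sgn ((y - z) \<bullet> u)"
  have P: "?P y = (if (y - z) \<bullet> u > 0 then chi_hat C u z y else sgn ((z - y) \<bullet> u))" for y
    using chi_hat_halfplane[of 1 "C \<inter> {p. (p - z) \<bullet> u > 0}" C z u y] by simp
  have M: "?M y = (if (y - z) \<bullet> u < 0 then chi_hat C u z y else sgn ((z - y) \<bullet> u))" for y
    using chi_hat_halfplane[of "-1" "C \<inter> {p. (p - z) \<bullet> u < 0}" C z u y] by simp
  have [measurable]: "chi_hat C u z \<in> borel_measurable borel"
    by (rule chi_hat_measurable[OF assms(1)])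
  \<comment> \<open>Measurability for the two halves is inherited from \<open>chi_hat C u z\<close>
    through the case formulas \<open>P\<close> and \<open>M\<close>.\<close>
  have meas: "?P \<in> borel_measurable borel" "?M \<in> borel_measurable borel" "?S \<in> borel_measurable borel"
    unfolding P[abs_def] M[abs_def] by measurable
  have int: "set_integrable lborel (- ball z \<epsilon>) (\<lambda>y. ?P y / ?k y)"
    "set_integrable lborel (- ball z \<epsilon>) (\<lambda>y. ?M y / ?k y)"
    "set_integrable lborel (- ball z \<epsilon>) (\<lambda>y. ?S y / ?k y)"
    by (intro kernel_integrable assms meas abs_chi_hat_le_1; simp add: sgn_if)+
  \<comment> \<open>Off the line, the half on the side of \<open>y\<close> contributes the value for
    \<open>C\<close> and the other half contributes \<open>- ?S y\<close>, which the last summand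
    cancels. On the line all terms vanish.\<close>
  have "chi_hat C u z y = ?P y + ?M y + ?S y" for y
    unfolding P M by (simp add: chi_hat_eq sgn_if inner_diff_left)
  then have "?I (chi_hat C u z) = ?I (\<lambda>y. ?P y + ?M y + ?S y)"
    by simp
  also have "\<dots> = ?I ?P + ?I ?M + ?I ?S"
    unfolding add_divide_distrib using int by (simp add: set_integral_add)
  finally show ?thesis
    by (simp add: truncated_curvature_def halfplane_integral_zero)
qed

text \<open>The auxiliary segment lies on the line through \<open>z\<close> orthogonal to \<open>u\<close>, to which
  \<open>chi_hat\<close> is blind; hence \<open>z \<notin> C\<close> needs no separate treatment.\<close>

lemma chi_hat_add_segment: "chi_hat (add_segment z C u \<delta>) u z = chi_hat C u z"
proof (rule chi_hat_off_line)
  fix p assume p: "(p - z) \<bullet> u \<noteq> 0"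
  let ?w = "\<delta> *\<^sub>R rot_clockwise u"
  have "rot_clockwise u \<bullet> u = 0"
    by (simp add: rot_clockwise_def inner_vec_def sum_2)
  moreover have "q - z = (2 * s * \<delta> - \<delta>) *\<^sub>R rot_clockwise u"
    if "q = (1 - s) *\<^sub>R (z - ?w) + s *\<^sub>R (z + ?w)" for q s
    unfolding that by (simp add: algebra_simps flip: scaleR_2)
  ultimately have "(q - z) \<bullet> u = 0" if "q \<in> closed_segment (z - ?w) (z + ?w)" for q
    using that unfolding in_segment by (metis inner_scaleR_left mult_zero_right)
  then have "p \<notin> closed_segment (z - ?w) (z + ?w)"
    using p by blast
  then show "p \<in> add_segment z C u \<delta> \<longleftrightarrow> p \<in> C"
    by (simp add: add_segment_def)
qed

lemma pv_curvature_add_segment: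
  "pv_curvature \<sigma> z (add_segment z C u \<delta>) u = pv_curvature \<sigma> z C u"
  "pv_curvature_exists \<sigma> z (add_segment z C u \<delta>) u \<longleftrightarrow> pv_curvature_exists \<sigma> z C u"
  by (simp_all add: pv_curvature_def pv_curvature_exists_def truncated_curvature_def[abs_def]
      chi_hat_add_segment)

text \<open>For \<open>z\<close> outside \<open>C\<close> the expression under the limit is constant
  in \<delta>, so the outer limit is trivial.\<close>

lemma nonlocal_curvature_eq_pv: "nonlocal_curvature \<sigma> z C u = pv_curvature \<sigma> z C u"
  by (simp add: nonlocal_curvature_def pv_curvature_add_segment tendsto_Lim)

lemma nonlocal_curvature_exists_iff_pv:
  "nonlocal_curvature_exists \<sigma> z C u \<longleftrightarrow> pv_curvature_exists \<sigma> z C u"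
  by (auto simp: nonlocal_curvature_exists_def pv_curvature_add_segment)

lemma pv_curvature_tendsto:
  assumes "pv_curvature_exists \<sigma> z C u"
  shows "(truncated_curvature \<sigma> z C u \<longlongrightarrow> pv_curvature \<sigma> z C u) (at_right 0)"
  using assms by (auto simp: pv_curvature_exists_def pv_curvature_def tendsto_Lim)

theorem proposition2:
  fixes \<sigma> :: real and C C_plus C_minus P_plus P_minus :: "(real^2) set" and z u :: "real^2"
  assumes "0 < \<sigma>" and "\<sigma> < 1"
    and "planar_curve C"
    and "norm u = 1"
    and "z \<in> C \<Longrightarrow> unit_normal C z u"
    and "P_minus = {p. (p - z) \<bullet> u \<le> 0}"
    and "P_plus = {p. (p - z) \<bullet> u \<ge> 0}"
    and "C_plus = C \<inter> interior P_plus"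
    and "C_minus = C \<inter> interior P_minus"
    and "nonlocal_curvature_exists \<sigma> z C_plus u"
    and "nonlocal_curvature_exists \<sigma> z C_minus u"
  shows "nonlocal_curvature_exists \<sigma> z C u \<and>
    nonlocal_curvature \<sigma> z C u =
      nonlocal_curvature \<sigma> z C_plus u + nonlocal_curvature \<sigma> z C_minus u"
proof -
  have "u \<noteq> 0"
    using assms(4) by auto
  \<comment> \<open>A nonzero \<open>u\<close> makes these genuine half-planes, whose interiors are
    given by the strict inequalities.\<close>
  then have "interior {p. u \<bullet> p \<ge> u \<bullet> z} = {p. u \<bullet> p > u \<bullet> z}"
    "interior {p. u \<bullet> p \<le> u \<bullet> z} = {p. u \<bullet> p < u \<bullet> z}"
    by simp_all
  moreover have "P_plus = {p. u \<bullet> p \<ge> u \<bullet> z}" "P_minus = {p. u \<bullet> p \<le> u \<bullet> z}"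
    using assms(6,7) by (auto simp: inner_diff_left inner_commute[of u])
  ultimately have "interior P_plus = {p. (p - z) \<bullet> u > 0}" "interior P_minus = {p. (p - z) \<bullet> u < 0}"
    by (simp_all add: inner_diff_left inner_commute[of u])
  then have C_pm: "C_plus = C \<inter> {p. (p - z) \<bullet> u > 0}" "C_minus = C \<inter> {p. (p - z) \<bullet> u < 0}"
    using assms(8,9) by simp_all
  have "((\<lambda>\<epsilon>. truncated_curvature \<sigma> z C_plus u \<epsilon> + truncated_curvature \<sigma> z C_minus u \<epsilon>)
      \<longlongrightarrow> pv_curvature \<sigma> z C_plus u + pv_curvature \<sigma> z C_minus u) (at_right 0)"
    using assms(10,11)
    by (intro tendsto_add pv_curvature_tendsto) (simp_all add: nonlocal_curvature_exists_iff_pv)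
  \<comment> \<open>The splitting holds for every positive \<epsilon>, so the limit of the sum is
    also the limit for \<open>C\<close>; this gives existence together with the value.\<close>
  moreover have "\<forall>\<^sub>F \<epsilon> in at_right 0. truncated_curvature \<sigma> z C u \<epsilon> =
      truncated_curvature \<sigma> z C_plus u \<epsilon> + truncated_curvature \<sigma> z C_minus u \<epsilon>"
    using eventually_at_right_less[of "0::real"]
  proof eventually_elim
    case (elim \<epsilon>)
    then show ?case
      unfolding C_pm using assms(1,3) by (intro truncated_curvature_split) (auto simp: planar_curve_def)
  qed
  ultimately have "(truncated_curvature \<sigma> z C u
      \<longlongrightarrow> pv_curvature \<sigma> z C_plus u + pv_curvature \<sigma> z C_minus u) (at_right 0)"
    by (simp add: tendsto_cong)
  then show ?thesis
    unfolding nonlocal_curvature_exists_iff_pv nonlocal_curvature_eq_pv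
    by (auto simp: pv_curvature_exists_def pv_curvature_def[of _ _ C] tendsto_Lim)
qed

end
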